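(* Suppose $G$ is a locally compact group which is not discrete. Given any $\mu\in M(G)$ and $x\in G\setminus\{e\}$, there exists a net $\{S_\alpha\}$ in $\mathscr C^+$ such that $\mu_{S_\alpha}\to\mu$, but $S_\alpha\cap xS_\alpha=\varnothing$ for all $\alpha$.
   Context: All groups are Hausdorff; $|E|$ is the left Haar measure of $E\subset G$. $L_\infty(G)$ is the algebra of bounded locally measurable functions on $G$ modulo equality off locally null sets ($E$ is locally null if $|E\cap K|=0$ for every compact $K$); it is the dual of $L_1(G)$. $M(G)$ is the set of means on $L_\infty(G)$: linear functionals $\mu$ with $\|\mu\|=1$ and $\mu\ge0$, endowed with the $w^*$-topology (convergence is in this topology). $\mathscr C^+$ is the set of compact subsets of $G$ with positive Haar measure. For $A\in\mathscr C^+$, $\mu_A=\mathbb 1_A/|A|\in L_1(G)$, regarded as the mean $\phi\mapsto\frac1{|A|}\int_A\phi(y)\,dy$. *)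

theory Defs
  imports "HOL-Analysis.Analysis"
begin

text \<open>
  The group \<open>G\<close> is a type of class \<open>topological_group_add\<close>. That class does not assume
  commutativity, so the group is arbitrary, but it is written additively: \<open>x + y\<close> is the
  product, \<open>0\<close> the identity, and \<open>(+) x ` S\<close> the left translate \<open>xS\<close>.
\<close>

definition left_haar_measure :: "'a::{topological_group_add, t2_space} measure \<Rightarrow> bool" where
  "left_haar_measure m \<longleftrightarrow>
     sets m = sets borel \<and>
     emeasure m UNIV \<noteq> 0 \<and>
     (\<forall>x. \<forall>A\<in>sets borel. emeasure m ((+) x ` A) = emeasure m A) \<and>
     (\<forall>K. compact K \<longrightarrow> emeasure m K < \<infinity>) \<and>
     (\<forall>A\<in>sets borel. emeasure m A = (INF U\<in>{U. open U \<and> A \<subseteq> U}. emeasure m U)) \<and>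
     (\<forall>U. open U \<longrightarrow> emeasure m U = (SUP K\<in>{K. compact K \<and> K \<subseteq> U}. emeasure m K))"

definition locally_null :: "'a::topological_space measure \<Rightarrow> 'a set \<Rightarrow> bool" where
  "locally_null m E \<longleftrightarrow> (\<forall>K. compact K \<longrightarrow> E \<inter> K \<in> null_sets (completion m))"

definition locally_measurable :: "'a::topological_space measure \<Rightarrow> ('a \<Rightarrow> complex) \<Rightarrow> bool" where
  "locally_measurable m f \<longleftrightarrow> (\<forall>K. compact K \<longrightarrow> set_borel_measurable (completion m) K f)"

text \<open>
  \<open>linf m\<close> is the set of representatives of \<open>L\<^sub>\<infinity>(G)\<close>. The quotient by equality off locally null
  sets is not formed; instead, \<open>linf_norm\<close> is the quotient norm, and functionals are required to
  be constant on the classes.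
\<close>

definition linf :: "'a::topological_space measure \<Rightarrow> ('a \<Rightarrow> complex) set" where
  "linf m = {f. locally_measurable m f \<and> bounded (range f)}"

definition linf_norm :: "'a::topological_space measure \<Rightarrow> ('a \<Rightarrow> complex) \<Rightarrow> real" where
  "linf_norm m f = Inf {c. 0 \<le> c \<and> locally_null m {x. c < cmod (f x)}}"

definition linf_functional ::
  "'a::topological_space measure \<Rightarrow> (('a \<Rightarrow> complex) \<Rightarrow> complex) \<Rightarrow> bool" where
  "linf_functional m \<mu> \<longleftrightarrow>
     \<mu> \<in> extensional (linf m) \<and>
     (\<forall>f\<in>linf m. \<forall>g\<in>linf m. locally_null m {x. f x \<noteq> g x} \<longrightarrow> \<mu> f = \<mu> g) \<and>
     (\<forall>f\<in>linf m. \<forall>g\<in>linf m. \<mu> (\<lambda>x. f x + g x) = \<mu> f + \<mu> g) \<and>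
     (\<forall>c. \<forall>f\<in>linf m. \<mu> (\<lambda>x. c * f x) = c * \<mu> f)"

definition dual_norm ::
  "'a::topological_space measure \<Rightarrow> (('a \<Rightarrow> complex) \<Rightarrow> complex) \<Rightarrow> ennreal" where
  "dual_norm m \<mu> = (SUP f\<in>{f\<in>linf m. linf_norm m f \<le> 1}. ennreal (cmod (\<mu> f)))"

definition means :: "'a::topological_space measure \<Rightarrow> (('a \<Rightarrow> complex) \<Rightarrow> complex) set" where
  "means m = {\<mu>. linf_functional m \<mu> \<and> dual_norm m \<mu> = 1 \<and>
     (\<forall>f\<in>linf m. locally_null m {x. f x \<notin> \<real>\<^sub>\<ge>\<^sub>0} \<longrightarrow> \<mu> f \<in> \<real>\<^sub>\<ge>\<^sub>0)}"

text \<open>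
  The \<open>w\<^sup>*\<close>-topology is the topology of pointwise convergence on \<open>linf m\<close>, that is, the one induced
  from the product topology.
\<close>

definition means_topology ::
  "'a::topological_space measure \<Rightarrow> (('a \<Rightarrow> complex) \<Rightarrow> complex) topology" where
  "means_topology m = subtopology (product_topology (\<lambda>_. euclidean) (linf m)) (means m)"

definition compact_pos :: "'a::topological_space measure \<Rightarrow> 'a set set" where
  "compact_pos m = {A. compact A \<and> 0 < emeasure m A}"

definition mean_of ::
  "'a::topological_space measure \<Rightarrow> 'a set \<Rightarrow> ('a \<Rightarrow> complex) \<Rightarrow> complex" where
  "mean_of m A = (\<lambda>f\<in>linf m.
     complex_of_real (1 / measure m A) * (LINT y:A|completion m. f y))"

text \<open>
  A net is a family indexed by a directed set \<open>D\<close>, preordered by \<open>le\<close>; it converges when it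
  converges along the filter of tails of \<open>D\<close>.
\<close>

definition directed_set :: "'i set \<Rightarrow> ('i \<Rightarrow> 'i \<Rightarrow> bool) \<Rightarrow> bool" where
  "directed_set D le \<longleftrightarrow>
     D \<noteq> {} \<and>
     (\<forall>a\<in>D. le a a) \<and>
     (\<forall>a\<in>D. \<forall>b\<in>D. \<forall>c\<in>D. le a b \<longrightarrow> le b c \<longrightarrow> le a c) \<and>
     (\<forall>a\<in>D. \<forall>b\<in>D. \<exists>c\<in>D. le a c \<and> le b c)"

definition tails :: "'i set \<Rightarrow> ('i \<Rightarrow> 'i \<Rightarrow> bool) \<Rightarrow> 'i filter" where
  "tails D le = (INF a\<in>D. principal {b\<in>D. le a b})"

lemma eventually_tails:
  assumes "directed_set D le"
  shows "eventually P (tails D le) \<longleftrightarrow> (\<exists>a\<in>D. \<forall>b\<in>D. le a b \<longrightarrow> P b)"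
proof -
  have "\<exists>c\<in>D. principal {x\<in>D. le c x} \<le> inf (principal {x\<in>D. le a x}) (principal {x\<in>D. le b x})"
    if ab: "a \<in> D" "b \<in> D" for a b
  proof -
    obtain c where c: "c \<in> D" "le a c" "le b c"
      using assms ab unfolding directed_set_def by blast
    have "le a x \<and> le b x" if "x \<in> D" "le c x" for x
      using assms ab c that unfolding directed_set_def by blast
    then show ?thesis
      using c by (intro bexI[of _ c]) auto
  qed
  moreover have "D \<noteq> {}"
    using assms unfolding directed_set_def by blast
  ultimately show ?thesis
    unfolding tails_def by (subst eventually_INF_base) (auto simp: eventually_principal)
qed

end

theory Submission
  imports Defs
begin

text \<open>
  The weak-star topology tests a mean at finitely many bounded functions only. Cutting the complex
  plane into small squares splits \<open>G\<close> into finitely many disjoint sets on which all of these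
  functions are nearly constant (\<open>finite_level_partition\<close>). Two means that give nearly the same
  weight to each of these sets therefore nearly agree at the given functions (\<open>mean_diff_le\<close>). So
  it is enough to find a compact \<open>S\<close> of positive measure, disjoint from its translate \<open>x + S\<close>, whose
  proportions in the level sets are close to the weights that \<open>\<mu>\<close> gives them.

  Such an \<open>S\<close> can be made from arbitrarily small pieces, because an average sees only the ratios of
  the measures of its pieces and not where in the level sets they lie. In a nondiscrete group points
  are null (\<open>left_haar_singleton_null\<close>), so every level set of positive weight has infinitely many
  points near which it has positive measure. One such point can be chosen in each of them so that
  no chosen point is the translate by \<open>x\<close> of another; sufficiently small neighbourhoods of these
  points are then disjoint from all the translates (\<open>compact_subsets_off_images\<close>). Inside these
  neighbourhoods, compact pieces with measures in nearly the right ratios exist because the measure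
  has no atoms (\<open>compact_subset_of_measure\<close>), and their union is \<open>S\<close>
  (\<open>compact_off_image_with_proportions\<close>). The construction is carried out for any
  continuous injection \<open>T\<close> without fixed points, of which translation by \<open>x\<close> is an example.

  The net is indexed by the open neighbourhoods of \<open>\<mu>\<close>.
\<close>

section \<open>Compact subsets for diffuse Radon measures\<close>

locale radon_measure =
  fixes m :: "'a::t2_space measure"
  assumes sets_borel: "sets m = sets borel"
    and compact_finite: "compact K \<Longrightarrow> emeasure m K < \<infinity>"
    and outer_regular: "A \<in> sets borel \<Longrightarrow> emeasure m A = (INF U\<in>{U. open U \<and> A \<subseteq> U}. emeasure m U)"
begin

lemma space_UNIV [simp]: "space m = UNIV"
  using sets_eq_imp_space_eq[OF sets_borel] by simp

lemma borel_in_sets [simp]: "A \<in> sets m \<longleftrightarrow> A \<in> sets borel"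
  by (simp add: sets_borel)

lemma compact_fmeasurable: "compact K \<Longrightarrow> K \<in> fmeasurable m"
  using compact_finite by (intro fmeasurableI) (auto intro: borel_compact)

text \<open>
  Outer regularity applied to the complement \<open>K - B\<close> gives an open \<open>U\<close> containing it with
  measure below that of \<open>K\<close>; then \<open>K - U\<close> is the required compact set. Finiteness on \<open>K\<close> makes the
  inequality strict.
\<close>

lemma compact_within_borel:
  assumes B: "B \<in> sets borel" "B \<subseteq> K" and K: "compact K" and pos: "0 < emeasure m B"
  obtains C where "compact C" "C \<subseteq> B" "0 < emeasure m C"
proof -
  have [measurable]: "K \<in> sets borel"
    by (rule borel_compact[OF K])
  have split: "emeasure m K = emeasure m (K - B) + emeasure m B"
    using B by (subst plus_emeasure) (auto intro!: arg_cong[where f="emeasure m"])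
  have "emeasure m (K - B) < emeasure m K"
    using split pos compact_finite[OF K]
    by (metis add.right_neutral ennreal_add_left_cancel_less infinity_ennreal_def ennreal_add_eq_top less_top)
  moreover have "K - B \<in> sets borel"
    using B by measurable
  ultimately obtain U where U: "open U" "K - B \<subseteq> U" "emeasure m U < emeasure m K"
    using outer_regular[of "K - B"] by (auto simp: INF_less_iff)
  have C: "compact (K - U)"
    using K U by (simp add: compact_diff)
  have "emeasure m K \<le> emeasure m (U \<union> (K - U))"
    using U C by (intro emeasure_mono) (auto intro: borel_compact)
  also have "\<dots> \<le> emeasure m U + emeasure m (K - U)"
    using U C by (intro emeasure_subadditive) (auto intro: borel_compact)
  finally have "emeasure m (K - U) \<noteq> 0"
    using U by auto
  then show thesis
    using C U by (intro that[of "K - U"]) (auto simp: zero_less_iff_neq_zero)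
qed

text \<open>
  A set that is only measurable for the completion has a Borel main part of the same measure,
  to which compact approximation from inside applies.
\<close>

lemma compact_within_not_locally_null:
  assumes meas: "\<And>K. compact K \<Longrightarrow> E \<inter> K \<in> sets (completion m)"
    and E: "\<not> locally_null m E"
  obtains C where "compact C" "C \<subseteq> E" "0 < emeasure m C"
proof -
  obtain K where K: "compact K" "E \<inter> K \<notin> null_sets (completion m)"
    using E unfolding locally_null_def by blast
  have "emeasure m (main_part m (E \<inter> K)) \<noteq> 0"
    using meas[OF K(1)] K(2) by (auto simp: null_sets_def)
  moreover have "main_part m (E \<inter> K) \<in> sets borel"
    using main_part_sets[OF meas[OF K(1)]] by simp
  moreover have "main_part m (E \<inter> K) \<subseteq> E \<inter> K"
    using main_part_null_part_Un[OF meas[OF K(1)]] by blast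
  ultimately show thesis
    using compact_within_borel[of "main_part m (E \<inter> K)" K] K(1) that
    by (metis Int_lower1 Int_lower2 subset_trans zero_less_iff_neq_zero)
qed

lemma compact_null_if_locally_null:
  assumes K: "compact K" and null: "\<And>a. a \<in> K \<Longrightarrow> \<exists>U. open U \<and> a \<in> U \<and> emeasure m (U \<inter> K) = 0"
  shows "emeasure m K = 0"
proof -
  let ?C = "{U. open U \<and> emeasure m (U \<inter> K) = 0}"
  obtain \<D> where \<D>: "\<D> \<subseteq> ?C" "finite \<D>" "K \<subseteq> \<Union>\<D>"
  proof (rule compactE[OF K])
    show "K \<subseteq> \<Union>?C"
      using null by blast
  qed auto
  have "K = (\<Union>U\<in>\<D>. U \<inter> K)"
    using \<D>(3) by blast
  also have "\<dots> \<in> null_sets m"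
    using \<D> borel_compact[OF K] by (intro null_sets_UN' countable_finite) (auto simp: null_sets_def subset_iff)
  finally show ?thesis
    by auto
qed

end

locale diffuse_radon_measure = radon_measure +
  assumes singleton_null: "emeasure m {a} = 0"
begin

lemma finite_null: "finite F \<Longrightarrow> F \<in> null_sets m"
proof (induction F rule: finite_induct)
  case (insert a F)
  then have "{a} \<union> F \<in> null_sets m"
    by (intro null_sets.Un) (auto simp: null_sets_def singleton_null)
  then show ?case by simp
qed simp

text \<open>
  If only finitely many points of \<open>C\<close> had all their neighbourhoods meeting \<open>C\<close> in positive
  measure, removing them would cost no measure, and a compact subset of the rest would be covered
  by finitely many null sets. Infinitude is what leaves room to avoid finitely many forbidden
  positions later.
\<close>

lemma infinite_density_points:
  assumes C: "compact C" and pos: "0 < emeasure m C"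
  shows "infinite {a \<in> C. \<forall>U. open U \<longrightarrow> a \<in> U \<longrightarrow> 0 < emeasure m (U \<inter> C)}" (is "infinite ?D")
proof
  assume fin: "finite ?D"
  note null = finite_null[OF fin]
  have [simp]: "C \<in> sets borel"
    using C by (rule borel_compact)
  have D: "?D \<in> sets borel"
    using null_setsD2[OF null] by simp
  have "emeasure m (C - ?D) = emeasure m C"
    using null by (rule emeasure_Diff_null_set) simp
  with pos obtain K where K: "compact K" "K \<subseteq> C - ?D" "0 < emeasure m K"
    using compact_within_borel[of "C - ?D" C] C sets.Diff[OF \<open>C \<in> sets borel\<close> D] by force
  have "emeasure m K = 0"
  proof (rule compact_null_if_locally_null[OF K(1)])
    fix a assume "a \<in> K"
    then obtain U where U: "open U" "a \<in> U" "emeasure m (U \<inter> C) = 0"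
      using K(2) by (auto simp: zero_less_iff_neq_zero)
    have "emeasure m (U \<inter> K) \<le> emeasure m (U \<inter> C)"
      using U K by (intro emeasure_mono) auto
    then show "\<exists>U. open U \<and> a \<in> U \<and> emeasure m (U \<inter> K) = 0"
      using U by auto
  qed
  with K(3) show False by simp
qed

text \<open>
  A substitute for the intermediate value property of nonatomic measures that stays inside
  compact sets: \<open>K\<close> is covered by finitely many open sets of measure below \<open>d\<close>, and deleting them one
  at a time lowers the measure in steps smaller than \<open>d\<close>, with compact sets at each stage.
\<close>

lemma compact_subset_of_measure:
  assumes K: "compact K" and s: "0 \<le> s" "s \<le> measure m K" and d: "0 < d"
  obtains B where "compact B" "B \<subseteq> K" "s \<le> measure m B" "measure m B < s + d"
proof -
  let ?C = "{U. open U \<and> emeasure m U < ennreal d}"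
  have "\<exists>U\<in>?C. a \<in> U" for a
  proof -
    have "(INF U\<in>{U. open U \<and> {a} \<subseteq> U}. emeasure m U) < ennreal d"
      using outer_regular[of "{a}"] singleton_null[of a] d by simp
    then show ?thesis
      by (auto simp: INF_less_iff)
  qed
  obtain \<D> where \<D>: "\<D> \<subseteq> ?C" "finite \<D>" "K \<subseteq> \<Union>\<D>"
  proof (rule compactE[OF K])
    show "K \<subseteq> \<Union>?C"
      using \<open>\<And>a. \<exists>U\<in>?C. a \<in> U\<close> by blast
  qed auto
  have ind: "\<exists>B. compact B \<and> B \<subseteq> L \<and> s \<le> measure m B \<and> measure m B < s + d"
    if "finite \<D>" "\<D> \<subseteq> ?C" "compact L" "s \<le> measure m L" "measure m (L - \<Union>\<D>) < s + d" for \<D> L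
    using that
  proof (induction \<D> arbitrary: L rule: finite_induct)
    case empty
    then show ?case by auto
  next
    case (insert U \<D>)
    have L: "compact (L - U)"
      using insert.prems by (auto intro: compact_diff)
    show ?case
    proof (cases "s \<le> measure m (L - U)")
      case True
      moreover have "L - U - \<Union>\<D> = L - \<Union>(insert U \<D>)"
        by blast
      ultimately show ?thesis
        using insert.IH[of "L - U"] insert.prems L by force
    next
      case False
      have U: "U \<in> fmeasurable m"
        using insert.prems by (auto intro!: fmeasurableI intro: less_trans)
      have d': "measure m U < d"
        using insert.prems emeasure_eq_measure2[OF U] d by (simp add: ennreal_less_iff)
      have "measure m L \<le> measure m ((L - U) \<union> U)"
        using insert.prems L U
        by (intro measure_mono_fmeasurable fmeasurable.Un) (auto intro: borel_compact compact_fmeasurable)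
      also have "\<dots> \<le> measure m (L - U) + measure m U"
        using L U by (intro measure_Un_le) (auto intro: borel_compact)
      finally show ?thesis
        using insert.prems False d' by (intro exI[of _ L]) auto
    qed
  qed
  have "K - \<Union>\<D> = {}"
    using \<D>(3) by blast
  then have "measure m (K - \<Union>\<D>) < s + d"
    using s d by (simp only: measure_empty)
  then show thesis
    using ind[OF \<D>(2,1) K s(2)] that by blast
qed

end


section \<open>Means on bounded locally measurable functions\<close>

lemma locally_null_subset: "locally_null m B \<Longrightarrow> A \<subseteq> B \<Longrightarrow> locally_null m A"
  unfolding locally_null_def by (meson Int_mono null_sets_completion_subset subset_refl)

lemma locally_null_empty: "locally_null m {}"
  by (simp add: locally_null_def)

lemma linf_add: "f \<in> linf m \<Longrightarrow> g \<in> linf m \<Longrightarrow> (\<lambda>x. f x + g x) \<in> linf m"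
  unfolding linf_def locally_measurable_def set_borel_measurable_def
  by (simp add: scaleR_add_right borel_measurable_add bounded_plus_comp)

lemma linf_cmult:
  assumes f: "f \<in> linf m"
  shows "(\<lambda>x. c * f x) \<in> linf m"
proof -
  have "(\<lambda>x. indicator K x *\<^sub>R (c * f x)) \<in> borel_measurable (completion m)"
    if "(\<lambda>x. indicator K x *\<^sub>R f x) \<in> borel_measurable (completion m)" for K
    using borel_measurable_times[OF borel_measurable_const[of c] that] by simp
  moreover have "bounded (range (\<lambda>x. c * f x))" if "bounded (range f)"
    using bounded_linear_image[OF that bounded_linear_mult_right[of c]] by (simp add: image_image)
  ultimately show ?thesis
    using f unfolding linf_def locally_measurable_def set_borel_measurable_def by simp
qed

lemma linf_diff: "f \<in> linf m \<Longrightarrow> g \<in> linf m \<Longrightarrow> (\<lambda>x. f x - g x) \<in> linf m"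
  using linf_add[OF _ linf_cmult[where c="-1"], of f m g] by simp

lemma linf_Re:
  assumes f: "f \<in> linf m"
  shows "(\<lambda>x. complex_of_real (Re (f x))) \<in> linf m"
proof -
  have "(\<lambda>x. indicator K x *\<^sub>R complex_of_real (Re (f x))) \<in> borel_measurable (completion m)"
    if "(\<lambda>x. indicator K x *\<^sub>R f x) \<in> borel_measurable (completion m)" for K
  proof -
    have "(\<lambda>x. complex_of_real (Re (indicator K x *\<^sub>R f x))) \<in> borel_measurable (completion m)"
      using that by measurable
    then show ?thesis
      by (simp add: scaleR_conv_of_real)
  qed
  moreover have "bounded (range (\<lambda>x. complex_of_real (Re (f x))))" if bd: "bounded (range f)"
  proof -
    obtain B where B: "cmod (f x) \<le> B" for x
      using bd by (auto simp: bounded_iff)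
    have "norm (complex_of_real (Re (f x))) \<le> B" for x
      using order.trans[OF abs_Re_le_cmod B] by simp
    then show ?thesis
      unfolding bounded_iff by blast
  qed
  ultimately show ?thesis
    using f unfolding linf_def locally_measurable_def set_borel_measurable_def by simp
qed

lemma linf_indicator:
  assumes "\<And>K. compact K \<Longrightarrow> E \<inter> K \<in> sets (completion m)"
  shows "indicator E \<in> linf m"
proof -
  have "(\<lambda>x. indicator K x *\<^sub>R indicator E x :: complex) = indicator (E \<inter> K)" for K
    by (auto simp: indicator_def fun_eq_iff)
  moreover have "bounded (range (indicator E :: 'a \<Rightarrow> complex))"
    unfolding bounded_iff by (intro exI[of _ 1]) (auto simp: indicator_def)
  ultimately show ?thesis
    using assms unfolding linf_def locally_measurable_def set_borel_measurable_def
    by (simp add: borel_measurable_indicator)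
qed

lemma mean_cong:
  "\<mu> \<in> means m \<Longrightarrow> f \<in> linf m \<Longrightarrow> g \<in> linf m \<Longrightarrow> locally_null m {x. f x \<noteq> g x} \<Longrightarrow> \<mu> f = \<mu> g"
  by (simp add: means_def linf_functional_def)

lemma mean_add:
  "\<mu> \<in> means m \<Longrightarrow> f \<in> linf m \<Longrightarrow> g \<in> linf m \<Longrightarrow> \<mu> (\<lambda>x. f x + g x) = \<mu> f + \<mu> g"
  by (simp add: means_def linf_functional_def)

lemma mean_cmult: "\<mu> \<in> means m \<Longrightarrow> f \<in> linf m \<Longrightarrow> \<mu> (\<lambda>x. c * f x) = c * \<mu> f"
  by (simp add: means_def linf_functional_def)

lemma mean_diff:
  "\<mu> \<in> means m \<Longrightarrow> f \<in> linf m \<Longrightarrow> g \<in> linf m \<Longrightarrow> \<mu> (\<lambda>x. f x - g x) = \<mu> f - \<mu> g"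
  using mean_add[OF _ _ linf_cmult[where c="-1"], of \<mu> m f g] mean_cmult[of \<mu> m g "-1"] by simp

lemma mean_nonneg:
  "\<mu> \<in> means m \<Longrightarrow> f \<in> linf m \<Longrightarrow> locally_null m {x. f x \<notin> \<real>\<^sub>\<ge>\<^sub>0} \<Longrightarrow> \<mu> f \<in> \<real>\<^sub>\<ge>\<^sub>0"
  by (simp add: means_def)

lemma linf_sum:
  assumes "finite J" "(\<lambda>_. 0) \<in> linf m" "\<And>j. j \<in> J \<Longrightarrow> f j \<in> linf m"
  shows "(\<lambda>x. \<Sum>j\<in>J. f j x) \<in> linf m"
  using assms by (induction J rule: finite_induct) (auto intro: linf_add)

lemma mean_sum:
  assumes \<mu>: "\<mu> \<in> means m" and 0: "(\<lambda>_. 0) \<in> linf m"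
    and J: "finite J" "\<And>j. j \<in> J \<Longrightarrow> f j \<in> linf m"
  shows "\<mu> (\<lambda>x. \<Sum>j\<in>J. f j x) = (\<Sum>j\<in>J. \<mu> (f j))"
  using J
proof (induction J rule: finite_induct)
  case empty
  show ?case
    using mean_cmult[OF \<mu> 0, of 0] by simp
next
  case (insert j J)
  then show ?case
    using mean_add[OF \<mu>, of "f j" "\<lambda>x. \<Sum>j\<in>J. f j x"] linf_sum[OF _ 0, of J f] by simp
qed

lemma linf_norm_le: "0 \<le> c \<Longrightarrow> locally_null m {x. c < cmod (f x)} \<Longrightarrow> linf_norm m f \<le> c"
  unfolding linf_norm_def by (intro cInf_lower bdd_belowI[of _ 0]) auto

text \<open>
  Boundedness of \<open>f\<close> keeps the infimum in the norm from ranging over the empty set, so some bound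
  below \<open>c\<close> holds off a locally null set.
\<close>

lemma locally_null_above_linf_norm:
  assumes f: "f \<in> linf m" and c: "linf_norm m f < c"
  shows "locally_null m {x. c < cmod (f x)}"
proof -
  obtain B where "cmod (f x) \<le> B" for x
    using f by (auto simp: linf_def bounded_iff)
  then have "{x. \<bar>B\<bar> < cmod (f x)} = {}"
    by (force simp: not_less intro: order.trans abs_ge_self)
  then have "{c. 0 \<le> c \<and> locally_null m {x. c < cmod (f x)}} \<noteq> {}"
    using locally_null_empty[of m] by (auto intro!: exI[of _ "\<bar>B\<bar>"])
  from cInf_lessD[OF this, of c] c obtain d where "d < c" "locally_null m {x. d < cmod (f x)}"
    by (auto simp: linf_norm_def)
  then show ?thesis
    by (auto elim: locally_null_subset)
qed

lemma mean_le_one: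
  assumes \<mu>: "\<mu> \<in> means m" and f: "f \<in> linf m" "linf_norm m f \<le> 1"
  shows "cmod (\<mu> f) \<le> 1"
proof -
  have "ennreal (cmod (\<mu> f)) \<le> dual_norm m \<mu>"
    unfolding dual_norm_def using f by (intro SUP_upper) auto
  then show ?thesis
    using \<mu> by (simp add: means_def)
qed

lemma mean_bound:
  assumes \<mu>: "\<mu> \<in> means m" and f: "f \<in> linf m" and r: "0 < r" "\<And>x. cmod (f x) \<le> r"
  shows "cmod (\<mu> f) \<le> r"
proof -
  have "linf_norm m (\<lambda>x. complex_of_real (1/r) * f x) \<le> 1"
    using r locally_null_empty[of m]
    by (intro linf_norm_le) (auto simp: norm_divide field_simps not_less[symmetric])
  then have "cmod (complex_of_real (1/r) * \<mu> f) \<le> 1"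
    using mean_le_one[OF \<mu> linf_cmult[OF f]] mean_cmult[OF \<mu> f] by metis
  then show ?thesis
    using r by (simp add: norm_divide norm_mult field_simps)
qed

text \<open>
  Adding a constant that dominates \<open>f\<close> makes the function nonnegative, so positivity applies.
\<close>

lemma mean_real:
  assumes \<mu>: "\<mu> \<in> means m" and one: "(\<lambda>_. 1) \<in> linf m"
    and f: "f \<in> linf m" "\<And>x. f x \<in> \<real>"
  shows "\<mu> f \<in> \<real>"
proof -
  obtain c where c: "cmod (f x) \<le> c" for x
    using f by (auto simp: linf_def bounded_iff)
  have c1: "(\<lambda>_. complex_of_real c) \<in> linf m"
    using linf_cmult[OF one, of "complex_of_real c"] by simp
  have "complex_of_real c + f x \<in> \<real>\<^sub>\<ge>\<^sub>0" for x
    using c[of x] f(2)[of x] by (auto elim!: Reals_cases simp flip: of_real_add)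
  then have "\<mu> (\<lambda>x. complex_of_real c + f x) \<in> \<real>\<^sub>\<ge>\<^sub>0"
    using locally_null_empty[of m] by (intro mean_nonneg[OF \<mu> linf_add[OF c1 f(1)]]) auto
  moreover have "\<mu> (\<lambda>x. complex_of_real c + f x) = complex_of_real c * \<mu> (\<lambda>_. 1) + \<mu> f"
    using mean_add[OF \<mu> c1 f(1)] mean_cmult[OF \<mu> one, of "complex_of_real c"] by simp
  moreover have "\<mu> (\<lambda>_. 1) \<in> \<real>\<^sub>\<ge>\<^sub>0"
    using locally_null_empty[of m] by (intro mean_nonneg[OF \<mu> one]) auto
  ultimately show ?thesis
    by (auto simp: complex_nonneg_Reals_iff complex_is_Real_iff)
qed

text \<open>
  Positivity and norm one force normalization. Rotating \<open>\<mu> f\<close> onto the positive axis, its modulus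
  is the value of \<open>\<mu>\<close> at a real function bounded by any \<open>c > 1\<close> off a locally null set, hence is at
  most \<open>c\<close> times the value at \<open>1\<close>. So the dual norm is at most the value at \<open>1\<close>.
\<close>

lemma mean_one:
  assumes \<mu>: "\<mu> \<in> means m" and one: "(\<lambda>_. 1) \<in> linf m"
  shows "\<mu> (\<lambda>_. 1) = 1"
proof -
  have one_nonneg: "\<mu> (\<lambda>_. 1) \<in> \<real>\<^sub>\<ge>\<^sub>0"
    using locally_null_empty[of m] by (intro mean_nonneg[OF \<mu> one]) auto
  have le: "cmod (\<mu> f) \<le> Re (\<mu> (\<lambda>_. 1))" if f: "f \<in> linf m" "linf_norm m f \<le> 1" for f
  proof (rule field_le_mult_one_interval)
    fix z :: real assume z: "0 < z" "z < 1"
    define c where "c = 1 / z"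
    have c: "1 < c" "0 < c"
      using z by (auto simp: c_def)
    define \<theta> where "\<theta> = cnj (sgn (\<mu> f))"
    have \<theta>: "\<theta> * \<mu> f = cmod (\<mu> f)"
      using complex_norm_square[of "\<mu> f"]
      by (cases "\<mu> f = 0") (auto simp: \<theta>_def sgn_div_norm scaleR_conv_of_real power2_eq_square field_simps)
    have \<theta>1: "cmod \<theta> \<le> 1"
      by (simp add: \<theta>_def norm_sgn)
    \<comment> \<open>The imaginary part is written as a real part so that \<open>linf_Re\<close> covers both.\<close>
    define g h where "g = (\<lambda>x. complex_of_real (Re (\<theta> * f x)))"
      and "h = (\<lambda>x. complex_of_real (Re (- \<i> * (\<theta> * f x))))"
    have g: "g \<in> linf m" and h: "h \<in> linf m"
      unfolding g_def h_def by (intro linf_Re linf_cmult f)+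
    have c1: "(\<lambda>_. complex_of_real c) \<in> linf m"
      using linf_cmult[OF one, of "complex_of_real c"] by simp
    have "(\<lambda>x. \<theta> * f x) = (\<lambda>x. g x + \<i> * h x)"
      by (auto simp: g_def h_def complex_eq_iff fun_eq_iff)
    then have "\<theta> * \<mu> f = \<mu> g + \<i> * \<mu> h"
      using mean_cmult[OF \<mu> f(1), of \<theta>] mean_add[OF \<mu> g linf_cmult[OF h]] mean_cmult[OF \<mu> h] by metis
    moreover have "\<mu> h \<in> \<real>"
      using h by (intro mean_real[OF \<mu> one]) (auto simp: h_def)
    ultimately have eq: "cmod (\<mu> f) = Re (\<mu> g)"
      unfolding \<theta> by (auto simp: complex_eq_iff complex_is_Real_iff)
    have "{x. complex_of_real c - g x \<notin> \<real>\<^sub>\<ge>\<^sub>0} \<subseteq> {x. c < cmod (f x)}"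
    proof safe
      fix x assume "complex_of_real c - g x \<notin> \<real>\<^sub>\<ge>\<^sub>0"
      then have "c < Re (\<theta> * f x)"
        by (auto simp: g_def complex_nonneg_Reals_iff)
      also have "\<dots> \<le> cmod \<theta> * cmod (f x)"
        using complex_Re_le_cmod[of "\<theta> * f x"] by (simp add: norm_mult)
      also have "\<dots> \<le> cmod (f x)"
        using \<theta>1 by (simp add: mult_left_le_one_le)
      finally show "c < cmod (f x)" .
    qed
    then have "\<mu> (\<lambda>x. complex_of_real c - g x) \<in> \<real>\<^sub>\<ge>\<^sub>0"
      using locally_null_above_linf_norm[OF f(1), of c] f(2) c
      by (intro mean_nonneg[OF \<mu> linf_diff[OF c1 g]]) (auto intro: locally_null_subset)
    moreover have "\<mu> (\<lambda>x. complex_of_real c - g x) = complex_of_real c * \<mu> (\<lambda>_. 1) - \<mu> g"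
      using mean_diff[OF \<mu> c1 g] mean_cmult[OF \<mu> one, of "complex_of_real c"] by simp
    ultimately have "cmod (\<mu> f) \<le> c * Re (\<mu> (\<lambda>_. 1))"
      by (simp add: eq complex_nonneg_Reals_iff)
    then show "z * cmod (\<mu> f) \<le> Re (\<mu> (\<lambda>_. 1))"
      using z by (simp add: c_def field_simps)
  qed
  have "dual_norm m \<mu> \<le> ennreal (Re (\<mu> (\<lambda>_. 1)))"
    unfolding dual_norm_def using le by (intro SUP_least) (auto intro: ennreal_leI)
  then have "1 \<le> Re (\<mu> (\<lambda>_. 1))"
    using \<mu> by (simp add: means_def)
  moreover have "cmod (\<mu> (\<lambda>_. 1)) \<le> 1"
    by (rule mean_bound[OF \<mu> one]) auto
  moreover have "Re (\<mu> (\<lambda>_. 1)) \<le> cmod (\<mu> (\<lambda>_. 1))"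
    by (rule complex_Re_le_cmod)
  ultimately show ?thesis
    using one_nonneg by (auto simp: complex_eq_iff complex_nonneg_Reals_iff)
qed

context radon_measure
begin

lemma linf_const: "(\<lambda>_. c) \<in> linf m"
proof -
  have "(indicator UNIV :: 'a \<Rightarrow> complex) \<in> linf m"
    by (rule linf_indicator) (auto intro!: sets_completionI_sets borel_compact)
  from linf_cmult[OF this, of c] show ?thesis
    by simp
qed

lemma mean_of_in_means:
  assumes S: "S \<in> compact_pos m"
  shows "mean_of m S \<in> means m"
proof -
  have Sm: "S \<in> sets m" and fin: "emeasure m S < \<infinity>" and K: "compact S"
    using S compact_finite by (auto simp: compact_pos_def intro: borel_compact)
  have pos: "0 < measure m S"
    using S fin by (simp add: compact_pos_def measure_def enn2real_positive_iff less_top)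
  have integrable: "set_integrable (completion m) S f" if f: "f \<in> linf m" for f
  proof -
    obtain B where B: "cmod (f x) \<le> B" for x
      using f by (auto simp: linf_def bounded_iff)
    have "(\<lambda>x. indicator S x *\<^sub>R f x) \<in> borel_measurable (completion m)"
      using f K by (simp add: linf_def locally_measurable_def set_borel_measurable_def)
    then have "integrable (completion m) (\<lambda>x. indicator S x *\<^sub>R (indicator S x *\<^sub>R f x))"
      using Sm fin B by (intro integrableI_bounded_set_indicator[where B=B]) auto
    moreover have "(\<lambda>x. indicator S x *\<^sub>R (indicator S x *\<^sub>R f x)) = (\<lambda>x. indicator S x *\<^sub>R f x)"
      by (auto simp: indicator_def)
    ultimately show ?thesis
      by (simp add: set_integrable_def)
  qed
  have AE: "AE x in completion m. x \<in> S \<longrightarrow> P x" if "locally_null m {x. \<not> P x}" for P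
  proof -
    have "{x. \<not> P x} \<inter> S \<in> null_sets (completion m)"
      using that K by (simp add: locally_null_def)
    then show ?thesis
      by (rule AE_I') auto
  qed
  have S1: "set_integrable (completion m) S (\<lambda>_. a)" for a :: real
    using Sm fin unfolding set_integrable_def by (intro integrableI_bounded_set_indicator[where B="\<bar>a\<bar>"]) auto
  have I1: "(LINT y:S|completion m. a) = a * measure m S" for a :: real
    using Sm fin by (simp add: set_lebesgue_integral_def)
  have bound: "cmod (mean_of m S f) \<le> c"
    if f: "f \<in> linf m" and c: "locally_null m {x. c < cmod (f x)}" for f c
  proof -
    have "cmod (LINT y:S|completion m. f y) \<le> (LINT y:S|completion m. cmod (f y))"
      unfolding set_lebesgue_integral_def
      using integral_norm_bound[of "completion m" "\<lambda>y. indicator S y *\<^sub>R f y"] by simp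
    also have "\<dots> \<le> (LINT y:S|completion m. c)"
      using integrable[OF f] c AE[of "\<lambda>x. cmod (f x) \<le> c"]
      by (intro set_integral_mono_AE S1 set_integrable_norm) (auto simp: not_le)
    also have "\<dots> = c * measure m S"
      by (rule I1)
    finally show ?thesis
      using f pos by (simp add: mean_of_def norm_mult norm_divide field_simps)
  qed
  have "mean_of m S \<in> extensional (linf m)"
    by (simp add: mean_of_def)
  moreover have "mean_of m S f = mean_of m S g"
    if f: "f \<in> linf m" and g: "g \<in> linf m" and n: "locally_null m {x. f x \<noteq> g x}" for f g
  proof -
    have "(LINT y:S|completion m. f y) = (LINT y:S|completion m. g y)"
      unfolding set_lebesgue_integral_def
    proof (rule integral_cong_AE)
      show "AE x in completion m. indicat_real S x *\<^sub>R f x = indicat_real S x *\<^sub>R g x"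
        using AE[of "\<lambda>x. f x = g x"] n by (auto simp: indicator_def)
    qed (use f g K in \<open>auto simp: linf_def locally_measurable_def set_borel_measurable_def\<close>)
    then show ?thesis
      using f g by (simp add: mean_of_def)
  qed
  moreover have "mean_of m S (\<lambda>x. f x + g x) = mean_of m S f + mean_of m S g"
    if f: "f \<in> linf m" and g: "g \<in> linf m" for f g
    using set_integral_add(2)[OF integrable[OF f] integrable[OF g]] f g linf_add[OF f g]
    by (simp add: mean_of_def add_divide_distrib)
  moreover have "mean_of m S (\<lambda>x. c * f x) = c * mean_of m S f" if f: "f \<in> linf m" for f c
    using f linf_cmult[OF f, of c] by (simp add: mean_of_def algebra_simps)
  moreover have "dual_norm m (mean_of m S) = 1"
  proof (rule antisym)
    show "dual_norm m (mean_of m S) \<le> 1"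
      unfolding dual_norm_def
    proof (rule SUP_least)
      fix f assume "f \<in> {f \<in> linf m. linf_norm m f \<le> 1}"
      then have f: "f \<in> linf m" "linf_norm m f \<le> 1" by auto
      have "cmod (mean_of m S f) \<le> 1"
      proof (rule field_le_epsilon)
        fix e :: real assume "0 < e"
        then show "cmod (mean_of m S f) \<le> 1 + e"
          using f by (intro bound locally_null_above_linf_norm) auto
      qed
      then show "ennreal (cmod (mean_of m S f)) \<le> 1"
        by simp
    qed
  next
    have "linf_norm m (\<lambda>_. 1) \<le> 1"
      using locally_null_empty[of m] by (intro linf_norm_le) auto
    moreover have "mean_of m S (\<lambda>_. 1) = 1"
      using pos Sm fin linf_const by (simp add: mean_of_def set_lebesgue_integral_def scaleR_conv_of_real)
    ultimately show "1 \<le> dual_norm m (mean_of m S)"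
      unfolding dual_norm_def by (intro SUP_upper2[of "\<lambda>_. 1"]) (auto simp: linf_const)
  qed
  moreover have "mean_of m S f \<in> \<real>\<^sub>\<ge>\<^sub>0"
    if f: "f \<in> linf m" and n: "locally_null m {x. f x \<notin> \<real>\<^sub>\<ge>\<^sub>0}" for f
  proof -
    have "(LINT y:S|completion m. f y) = (LINT y:S|completion m. complex_of_real (Re (f y)))"
      unfolding set_lebesgue_integral_def
    proof (rule integral_cong_AE)
      show "AE x in completion m. indicat_real S x *\<^sub>R f x = indicat_real S x *\<^sub>R complex_of_real (Re (f x))"
        using AE[of "\<lambda>x. f x \<in> \<real>\<^sub>\<ge>\<^sub>0"] n by (auto simp: complex_eq_iff complex_nonneg_Reals_iff)
    qed (use f linf_Re[OF f] K in \<open>auto simp: linf_def locally_measurable_def set_borel_measurable_def\<close>)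
    also have "\<dots> = complex_of_real (LINT y:S|completion m. Re (f y))"
      by (rule set_integral_complex_of_real)
    finally have "(LINT y:S|completion m. f y) = complex_of_real (LINT y:S|completion m. Re (f y))" .
    moreover have "0 \<le> (LINT y:S|completion m. Re (f y))"
      unfolding set_lebesgue_integral_def
      using AE[of "\<lambda>x. f x \<in> \<real>\<^sub>\<ge>\<^sub>0"] n
      by (intro integral_nonneg_AE) (auto simp: complex_nonneg_Reals_iff indicator_def)
    ultimately show ?thesis
      using f by (simp add: mean_of_def complex_nonneg_Reals_iff)
  qed
  ultimately show ?thesis
    by (simp add: means_def linf_functional_def)
qed

lemma mean_of_indicator:
  assumes S: "S \<in> compact_pos m" and E: "indicator E \<in> linf m" and SE: "S \<inter> E \<in> sets m"
  shows "mean_of m S (indicator E) = complex_of_real (measure m (S \<inter> E) / measure m S)"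
proof -
  have "emeasure m (S \<inter> E) \<le> emeasure m S"
    using S by (intro emeasure_mono) (auto simp: compact_pos_def intro: borel_compact)
  then have fin: "emeasure m (S \<inter> E) < \<infinity>"
    using S compact_finite[of S] by (auto simp: compact_pos_def)
  have "(LINT y:S|completion m. (indicator E y :: complex)) = (LINT y|completion m. complex_of_real (indicator (S \<inter> E) y))"
    unfolding set_lebesgue_integral_def by (intro Bochner_Integration.integral_cong) (auto simp: indicator_def)
  also have "\<dots> = complex_of_real (measure m (S \<inter> E))"
    using SE fin by simp
  finally show ?thesis
    using E by (simp add: mean_of_def)
qed

end

section \<open>Reduction to finitely many level sets\<close>

text \<open>
  The label \<open>h y\<close> records, for each \<open>f\<close> in \<open>F\<close>, the square of side \<open>d\<close> in the complex plane that
  contains \<open>f y\<close>. Boundedness leaves finitely many labels, and all functions in \<open>F\<close> are nearly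
  constant on each level set simultaneously.
\<close>

lemma (in radon_measure) finite_level_partition:
  assumes F: "finite F" "F \<subseteq> linf m" and d: "0 < d"
  obtains h :: "'a \<Rightarrow> ('a \<Rightarrow> complex) \<Rightarrow> int \<times> int" where
    "finite (range h)"
    "\<And>j K. compact K \<Longrightarrow> h -` {j} \<inter> K \<in> sets (completion m)"
    "\<And>f y z. f \<in> F \<Longrightarrow> h y = h z \<Longrightarrow> cmod (f y - f z) \<le> 2 * d"
proof
  define h where "h = (\<lambda>y. \<lambda>f\<in>F. (\<lfloor>Re (f y) / d\<rfloor>, \<lfloor>Im (f y) / d\<rfloor>))"
  have "\<exists>B. \<forall>y. cmod (f y) \<le> B" if "f \<in> F" for f
    using F that by (auto simp: linf_def bounded_iff)
  then obtain B where B: "\<And>f y. f \<in> F \<Longrightarrow> cmod (f y) \<le> B f"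
    by metis
  let ?I = "\<lambda>f. {\<lfloor>- B f / d\<rfloor>..\<lfloor>B f / d\<rfloor>}"
  have "h y \<in> (\<Pi>\<^sub>E f\<in>F. ?I f \<times> ?I f)" for y
  proof -
    have "\<bar>Re (f y) / d\<bar> \<le> B f / d" "\<bar>Im (f y) / d\<bar> \<le> B f / d" if "f \<in> F" for f
      using order.trans[OF abs_Re_le_cmod B[OF that]] order.trans[OF abs_Im_le_cmod B[OF that]] d
      by (simp_all add: abs_divide divide_right_mono)
    then have "- (B f / d) \<le> Re (f y) / d" "Re (f y) / d \<le> B f / d"
      "- (B f / d) \<le> Im (f y) / d" "Im (f y) / d \<le> B f / d" if "f \<in> F" for f
      using that by (metis abs_le_iff minus_le_iff)+
    then show ?thesis
      by (auto simp: h_def intro!: floor_mono)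
  qed
  then have "range h \<subseteq> (\<Pi>\<^sub>E f\<in>F. ?I f \<times> ?I f)"
    by blast
  then show "finite (range h)"
    by (rule finite_subset) (auto intro!: finite_PiE F)
  show "h -` {j} \<inter> K \<in> sets (completion m)" if K: "compact K" for j K
  proof (cases "j \<in> extensional F")
    case False
    then have "h -` {j} \<inter> K = {}"
      by (auto simp: h_def)
    then show ?thesis by simp
  next
    case True
    \<comment> \<open>Multiplying by the indicator of \<open>K\<close> makes the conditions measurable without changing them on \<open>K\<close>.\<close>
    let ?P = "\<lambda>f y. \<lfloor>Re (indicator K y *\<^sub>R f y) / d\<rfloor> = fst (j f) \<and> \<lfloor>Im (indicator K y *\<^sub>R f y) / d\<rfloor> = snd (j f)"
    have "{y \<in> space (completion m). ?P f y} \<in> sets (completion m)" if "f \<in> F" for f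
    proof -
      have [measurable]: "(\<lambda>y. indicator K y *\<^sub>R f y) \<in> borel_measurable (completion m)"
        using F that K by (auto simp: linf_def locally_measurable_def set_borel_measurable_def)
      show ?thesis
        by measurable
    qed
    then have "{y \<in> space (completion m). \<forall>f\<in>F. ?P f y} \<in> sets (completion m)"
      using F by (intro sets.sets_Collect_finite_All) auto
    moreover have "K \<in> sets (completion m)"
      using K by (auto intro!: sets_completionI_sets borel_compact)
    moreover have "h -` {j} \<inter> K = {y \<in> space (completion m). \<forall>f\<in>F. ?P f y} \<inter> K"
      using True by (auto simp: h_def fun_eq_iff extensional_def prod_eq_iff split: if_splits)
    ultimately show ?thesis
      by auto
  qed
  show "cmod (f y - f z) \<le> 2 * d" if f: "f \<in> F" and eq: "h y = h z" for f y z
  proof -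
    have close: "\<bar>a - b\<bar> \<le> d" if "\<lfloor>a / d\<rfloor> = \<lfloor>b / d\<rfloor>" for a b :: real
    proof -
      have "\<bar>a / d - b / d\<bar> \<le> 1"
        using that floor_correct[of "a / d"] floor_correct[of "b / d"] by linarith
      then show ?thesis
        using d by (simp add: diff_divide_distrib[symmetric] abs_divide)
    qed
    have "\<lfloor>Re (f y) / d\<rfloor> = \<lfloor>Re (f z) / d\<rfloor>" "\<lfloor>Im (f y) / d\<rfloor> = \<lfloor>Im (f z) / d\<rfloor>"
      using fun_cong[OF eq, of f] f by (auto simp: h_def)
    then show ?thesis
      using close[of "Re (f y)" "Re (f z)"] close[of "Im (f y)" "Im (f z)"] cmod_le[of "f y - f z"] by simp
  qed
qed

text \<open>
  The function \<open>f\<close> is uniformly close to a combination of the indicators of the level sets, and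
  means are contractive. Applied with \<open>\<nu>\<close> the average over a compact set, this reduces the
  approximation problem to proportions of measures.
\<close>

lemma mean_diff_le:
  assumes \<mu>: "\<mu> \<in> means m" and \<nu>: "\<nu> \<in> means m" and f: "f \<in> linf m"
    and h: "finite (range h)" "\<And>j. indicator (h -` {j}) \<in> linf m"
    and r: "0 < r" "\<And>y. cmod (f y - c (h y)) \<le> r"
  shows "cmod (\<mu> f - \<nu> f) \<le>
    2 * r + (\<Sum>j\<in>range h. cmod (c j) * cmod (\<mu> (indicator (h -` {j})) - \<nu> (indicator (h -` {j}))))"
proof -
  let ?g = "\<lambda>x. \<Sum>j\<in>range h. c j * indicator (h -` {j}) x"
  have 0: "(\<lambda>_. 0) \<in> linf m"
    using linf_cmult[OF f, of 0] by simp
  have g: "?g \<in> linf m"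
    by (intro linf_sum h 0 linf_cmult)
  have "?g y = c (h y)" for y
    using h(1) by (subst sum.remove[of _ "h y"]) (auto intro!: sum.neutral)
  then have le: "cmod (f y - ?g y) \<le> r" for y
    using r(2) by simp
  have "cmod (\<kappa> f - \<kappa> ?g) \<le> r" if \<kappa>: "\<kappa> \<in> means m" for \<kappa>
    using mean_bound[OF \<kappa> linf_diff[OF f g] r(1) le] mean_diff[OF \<kappa> f g] by simp
  from this[OF \<mu>] this[OF \<nu>]
  have "cmod (\<mu> f - \<nu> f) \<le> 2 * r + cmod (\<mu> ?g - \<nu> ?g)"
    using norm_triangle_ineq[of "\<mu> f - \<mu> ?g" "\<mu> ?g - \<nu> f"] norm_triangle_ineq[of "\<mu> ?g - \<nu> ?g" "\<nu> ?g - \<nu> f"]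
    by (simp add: norm_minus_commute)
  moreover have "\<kappa> ?g = (\<Sum>j\<in>range h. c j * \<kappa> (indicator (h -` {j})))" if \<kappa>: "\<kappa> \<in> means m" for \<kappa>
    using mean_sum[OF \<kappa> 0 h(1), of "\<lambda>j x. c j * indicator (h -` {j}) x"] mean_cmult[OF \<kappa> h(2)] linf_cmult[OF h(2)]
    by simp
  then have "\<mu> ?g - \<nu> ?g = (\<Sum>j\<in>range h. c j * (\<mu> (indicator (h -` {j})) - \<nu> (indicator (h -` {j}))))"
    using \<mu> \<nu> by (simp add: sum_subtractf right_diff_distrib)
  then have "cmod (\<mu> ?g - \<nu> ?g) \<le>
      (\<Sum>j\<in>range h. cmod (c j) * cmod (\<mu> (indicator (h -` {j})) - \<nu> (indicator (h -` {j}))))"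
    by (auto simp: norm_mult[symmetric] intro: norm_sum)
  ultimately show ?thesis
    by linarith
qed

section \<open>Prescribed proportions off an image\<close>

text \<open>
  Points are chosen one after another. A new point \<open>b\<close> must avoid the images and, by injectivity,
  the finitely many preimages of the points already chosen; that \<open>T\<close> moves \<open>b\<close> itself settles the
  remaining condition.
\<close>

lemma choose_avoiding_map:
  assumes "finite I" and D: "\<And>i. i \<in> I \<Longrightarrow> infinite (D i)"
    and T: "inj T" "\<And>a. T a \<noteq> a"
  shows "\<exists>a. (\<forall>i\<in>I. a i \<in> D i) \<and> (\<forall>i\<in>I. \<forall>j\<in>I. a i \<noteq> T (a j))"
  using assms(1) D
proof (induction I rule: finite_induct)
  case (insert k I)
  then obtain a where a: "\<forall>i\<in>I. a i \<in> D i" "\<forall>i\<in>I. \<forall>j\<in>I. a i \<noteq> T (a j)"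
    by auto
  have "finite (T ` a ` I \<union> T -` a ` I)"
    using insert.hyps T by (auto intro: finite_vimageI)
  then have "infinite (D k - (T ` a ` I \<union> T -` a ` I))"
    using insert.prems[of k] by simp
  then have "D k - (T ` a ` I \<union> T -` a ` I) \<noteq> {}"
    by (rule infinite_imp_nonempty)
  then obtain b where "b \<in> D k - (T ` a ` I \<union> T -` a ` I)"
    by blast
  then have b: "b \<in> D k" "\<And>j. j \<in> I \<Longrightarrow> b \<noteq> T (a j)" "\<And>i. i \<in> I \<Longrightarrow> a i \<noteq> T b" "b \<noteq> T b"
    using T(2)[of b] by (auto simp: image_iff)
  let ?a = "a(k := b)"
  have "?a i \<in> D i" if "i \<in> insert k I" for i
    using that a(1) b(1) by auto
  moreover have "?a i \<noteq> T (?a j)" if "i \<in> insert k I" "j \<in> insert k I" for i j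
    using that a(2) b(2-4) by auto
  ultimately show ?case
    by blast
qed simp

lemma separating_neighbourhoods:
  fixes a :: "'i \<Rightarrow> 'a::t2_space"
  assumes I: "finite I" and T: "continuous_on UNIV T"
    and a: "\<And>i j. i \<in> I \<Longrightarrow> j \<in> I \<Longrightarrow> a i \<noteq> T (a j)"
  obtains V where "\<And>i. i \<in> I \<Longrightarrow> open (V i)" "\<And>i. i \<in> I \<Longrightarrow> a i \<in> V i"
    "\<And>i j. i \<in> I \<Longrightarrow> j \<in> I \<Longrightarrow> V i \<inter> T ` V j = {}"
proof -
  have "\<exists>U W. open U \<and> open W \<and> a i \<in> U \<and> T (a j) \<in> W \<and> U \<inter> W = {}" if "i \<in> I" "j \<in> I" for i j
    using a[OF that] by (rule hausdorff)
  then obtain U W where UW: "\<And>i j. i \<in> I \<Longrightarrow> j \<in> I \<Longrightarrow>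
      open (U i j) \<and> open (W i j) \<and> a i \<in> U i j \<and> T (a j) \<in> W i j \<and> U i j \<inter> W i j = {}"
    by metis
  show thesis
  proof
    let ?V = "\<lambda>k. (\<Inter>j\<in>I. U k j) \<inter> (\<Inter>i\<in>I. T -` W i k)"
    show "open (?V i)" "a i \<in> ?V i" if "i \<in> I" for i
      using UW that I T by (auto intro!: open_Int open_INT open_vimage)
    show "?V i \<inter> T ` ?V j = {}" if "i \<in> I" "j \<in> I" for i j
      using UW[OF that] that by auto
  qed
qed

context diffuse_radon_measure
begin

text \<open>
  Density points in general position have neighbourhoods that \<open>T\<close> moves off one another, and near
  a density point the set \<open>C i\<close> retains positive measure.
\<close>

lemma compact_subsets_off_images:
  assumes I: "finite I" and C: "\<And>i. i \<in> I \<Longrightarrow> compact (C i)" "\<And>i. i \<in> I \<Longrightarrow> 0 < emeasure m (C i)"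
    and T: "continuous_on UNIV T" "inj T" "\<And>a. T a \<noteq> a"
  obtains L where "\<And>i. i \<in> I \<Longrightarrow> compact (L i)" "\<And>i. i \<in> I \<Longrightarrow> L i \<subseteq> C i"
    "\<And>i. i \<in> I \<Longrightarrow> 0 < emeasure m (L i)" "\<And>i j. i \<in> I \<Longrightarrow> j \<in> I \<Longrightarrow> L i \<inter> T ` L j = {}"
proof -
  define D where "D i = {a \<in> C i. \<forall>U. open U \<longrightarrow> a \<in> U \<longrightarrow> 0 < emeasure m (U \<inter> C i)}" for i
  have "\<exists>a. (\<forall>i\<in>I. a i \<in> D i) \<and> (\<forall>i\<in>I. \<forall>j\<in>I. a i \<noteq> T (a j))"
  proof (rule choose_avoiding_map[OF I _ T(2,3)])
    show "infinite (D i)" if "i \<in> I" for i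
      unfolding D_def using C that by (intro infinite_density_points)
  qed
  then obtain a where a: "\<And>i. i \<in> I \<Longrightarrow> a i \<in> D i" "\<And>i j. i \<in> I \<Longrightarrow> j \<in> I \<Longrightarrow> a i \<noteq> T (a j)"
    by blast
  obtain V where V: "\<And>i. i \<in> I \<Longrightarrow> open (V i)" "\<And>i. i \<in> I \<Longrightarrow> a i \<in> V i"
    "\<And>i j. i \<in> I \<Longrightarrow> j \<in> I \<Longrightarrow> V i \<inter> T ` V j = {}"
    by (rule separating_neighbourhoods[OF I T(1) a(2)]) auto
  have "\<exists>L. compact L \<and> L \<subseteq> V i \<inter> C i \<and> 0 < emeasure m L" if i: "i \<in> I" for i
  proof -
    have "V i \<inter> C i \<in> sets borel" "0 < emeasure m (V i \<inter> C i)"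
      using V(1,2)[OF i] a(1)[OF i] C(1)[OF i] by (auto simp: D_def intro: borel_compact)
    then show ?thesis
      using compact_within_borel[of "V i \<inter> C i" "C i"] C(1)[OF i] by (metis Int_lower2)
  qed
  then obtain L where L: "\<And>i. i \<in> I \<Longrightarrow> compact (L i) \<and> L i \<subseteq> V i \<inter> C i \<and> 0 < emeasure m (L i)"
    by metis
  then have "L i \<inter> T ` L j = {}" if "i \<in> I" "j \<in> I" for i j
    using V(3)[OF that] that by blast
  with L show thesis
    by (intro that[of L]) auto
qed

text \<open>
  Once the pieces \<open>L i\<close> are off the images of each other, only ratios of measures matter, so it
  suffices to shrink each piece to measure about \<open>t * p i\<close> for one common scale \<open>t\<close>. Passing to
  subsets preserves disjointness from the images.
\<close>

lemma compact_off_image_with_proportions: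
  assumes J: "finite J" "disjoint_family_on E J"
    and p: "\<And>j. j \<in> J \<Longrightarrow> 0 \<le> p j" "(\<Sum>j\<in>J. p j) = 1"
    and C: "\<And>j. j \<in> J \<Longrightarrow> 0 < p j \<Longrightarrow> \<exists>C. compact C \<and> C \<subseteq> E j \<and> 0 < emeasure m C"
    and T: "continuous_on UNIV T" "inj T" "\<And>a. T a \<noteq> a"
    and e: "0 < e"
  obtains S where "S \<in> compact_pos m" "S \<inter> T ` S = {}"
    "\<And>j. j \<in> J \<Longrightarrow> S \<inter> E j \<in> sets m"
    "\<And>j. j \<in> J \<Longrightarrow> \<bar>measure m (S \<inter> E j) / measure m S - p j\<bar> \<le> e"
proof -
  \<comment> \<open>Only pieces with positive weight contribute; the others may contain no compact set of positive measure.\<close>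
  define I where "I = {j \<in> J. 0 < p j}"
  have I: "finite I" "I \<subseteq> J"
    using J by (auto simp: I_def)
  have p0: "p j = 0" if "j \<in> J - I" for j
    using that p(1)[of j] by (auto simp: I_def)
  then have pI: "(\<Sum>j\<in>I. p j) = 1"
    using p(2) sum.mono_neutral_left[OF J(1) I(2), of p] by auto
  then have "I \<noteq> {}"
    by auto
  have p1: "p j \<le> 1" if "j \<in> J" for j
    using p(2) member_le_sum[OF that _ J(1), of p] p(1) by auto
  have "\<forall>j\<in>I. \<exists>C. compact C \<and> C \<subseteq> E j \<and> 0 < emeasure m C"
    using C by (auto simp: I_def)
  then obtain C where C: "\<And>j. j \<in> I \<Longrightarrow> compact (C j)" "\<And>j. j \<in> I \<Longrightarrow> C j \<subseteq> E j" "\<And>j. j \<in> I \<Longrightarrow> 0 < emeasure m (C j)"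
    by metis
  obtain L where L: "\<And>i. i \<in> I \<Longrightarrow> compact (L i)" "\<And>i. i \<in> I \<Longrightarrow> L i \<subseteq> C i"
    "\<And>i. i \<in> I \<Longrightarrow> 0 < emeasure m (L i)" "\<And>i j. i \<in> I \<Longrightarrow> j \<in> I \<Longrightarrow> L i \<inter> T ` L j = {}"
    using compact_subsets_off_images[of I C T, OF I(1) C(1) C(3) T] by blast
  define t where "t = Min ((\<lambda>i. measure m (L i)) ` I)"
  have Lpos: "0 < measure m (L i)" if "i \<in> I" for i
    using L(3)[OF that] compact_finite[OF L(1)[OF that]]
    by (simp add: measure_def enn2real_positive_iff less_top)
  have t: "0 < t" "\<And>i. i \<in> I \<Longrightarrow> t \<le> measure m (L i)"
    using I(1) \<open>I \<noteq> {}\<close> Lpos by (auto simp: t_def)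
  \<comment> \<open>The errors in the measures of all the pieces together amount to at most \<open>t * e\<close>.\<close>
  define d where "d = t * e / card I"
  have cI: "0 < card I"
    using I \<open>I \<noteq> {}\<close> by (simp add: card_gt_0_iff)
  then have d: "0 < d" "real (card I) * d = t * e"
    using t e by (auto simp: d_def)
  have "\<exists>B. compact B \<and> B \<subseteq> L i \<and> t * p i \<le> measure m B \<and> measure m B < t * p i + d" if i: "i \<in> I" for i
  proof -
    have "i \<in> J"
      using I(2) i by blast
    then have "0 \<le> t * p i" "t * p i \<le> t"
      using t(1) p(1) p1 by (auto intro: mult_left_le)
    then have "0 \<le> t * p i" "t * p i \<le> measure m (L i)"
      using t(2)[OF i] by auto
    with compact_subset_of_measure[OF L(1)[OF i] _ _ d(1)]
    obtain B where "compact B" "B \<subseteq> L i" "t * p i \<le> measure m B" "measure m B < t * p i + d"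
      by metis
    then show ?thesis
      by (intro exI[of _ B] conjI)
  qed
  then obtain B where B: "\<And>i. i \<in> I \<Longrightarrow> compact (B i)" "\<And>i. i \<in> I \<Longrightarrow> B i \<subseteq> L i"
    "\<And>i. i \<in> I \<Longrightarrow> t * p i \<le> measure m (B i)" "\<And>i. i \<in> I \<Longrightarrow> measure m (B i) < t * p i + d"
    by metis
  define S where "S = (\<Union>i\<in>I. B i)"
  have S: "compact S"
    using I(1) B(1) unfolding S_def by (rule compact_UN)
  have BE: "B i \<subseteq> E i" if "i \<in> I" for i
    using B(2) L(2) C(2) that by blast
  have SE: "S \<inter> E j = (if j \<in> I then B j else {})" if j: "j \<in> J" for j
  proof -
    have "i = j" if "i \<in> I" "y \<in> B i" "y \<in> E j" for i y
      using J(2) I(2) BE[OF that(1)] that j unfolding disjoint_family_on_def by blast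
    then show ?thesis
      using BE by (auto simp: S_def)
  qed
  have mS_eq: "measure m S = (\<Sum>i\<in>I. measure m (B i))"
    unfolding S_def
  proof (rule measure_finite_Union[OF I(1)])
    show "disjoint_family_on B I"
      using J(2) I(2) BE unfolding disjoint_family_on_def by blast
    show "B ` I \<subseteq> sets m"
      using borel_compact[OF B(1)] by auto
    show "emeasure m (B i) \<noteq> \<infinity>" if "i \<in> I" for i
      using compact_finite[OF B(1)[OF that]] by auto
  qed
  have sums: "(\<Sum>i\<in>I. t * p i) = t" "(\<Sum>i\<in>I. t * p i + d) = t + t * e"
    using pI d(2) by (simp_all add: sum.distrib flip: sum_distrib_left)
  have mS: "t \<le> measure m S" "measure m S \<le> t + t * e"
    unfolding mS_eq
    using sum_mono[of I "\<lambda>i. t * p i" "\<lambda>i. measure m (B i)", OF B(3)]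
      sum_mono[of I "\<lambda>i. measure m (B i)" "\<lambda>i. t * p i + d", OF less_imp_le[OF B(4)]]
    by (simp_all add: sums)
  show thesis
  proof
    show "S \<in> compact_pos m"
      using S mS t(1) by (auto simp: compact_pos_def measure_def zero_less_iff_neq_zero)
    show "S \<inter> T ` S = {}"
    proof -
      have "B i \<inter> T ` B j = {}" if "i \<in> I" "j \<in> I" for i j
        using L(4)[OF that] B(2)[OF that(1)] B(2)[OF that(2)] by blast
      then show ?thesis
        by (fastforce simp: S_def)
    qed
    show "S \<inter> E j \<in> sets m" if "j \<in> J" for j
      using SE[OF that] borel_compact[OF B(1)] by auto
    show "\<bar>measure m (S \<inter> E j) / measure m S - p j\<bar> \<le> e" if j: "j \<in> J" for j
    proof (cases "j \<in> I")
      case False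
      then show ?thesis
        using SE[OF j] p0[of j] j e by simp
    next
      case True
      have pos: "0 < measure m S"
        using mS t by linarith
      have "1 * d \<le> card I * d"
        using cI d(1) by (intro mult_right_mono) auto
      then have "measure m (B j) \<le> t * p j + t * e"
        using B(4)[OF True] d(2) by simp
      also have "\<dots> \<le> measure m S * p j + measure m S * e"
        using mS p(1)[OF j] e by (intro add_mono mult_right_mono) auto
      finally have upper: "measure m (B j) \<le> measure m S * p j + measure m S * e" .
      have "measure m S * p j \<le> (t + t * e) * p j"
        using mS p(1)[OF j] by (intro mult_right_mono) auto
      also have "\<dots> \<le> t * p j + t * e"
        using p1[OF j] t(1) e mult_left_le[of "p j" "t * e"] by (simp add: algebra_simps)
      also have "\<dots> \<le> measure m (B j) + measure m S * e"
        using B(3)[OF True] mS e by (intro add_mono mult_right_mono) auto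
      finally have lower: "measure m S * p j \<le> measure m (B j) + measure m S * e" .
      show ?thesis
        using upper lower pos SE[OF j] True by (simp add: abs_le_iff field_simps)
    qed
  qed
qed

end

section \<open>Approximation in the weak-star topology\<close>

text \<open>
  The weights to be imitated are the values of \<open>\<mu>\<close> at the indicators of the level sets. A level
  set of positive weight is not locally null, since \<open>\<mu>\<close> respects equality off locally null sets, so
  it contains a compact set of positive measure to draw from.
\<close>

lemma (in diffuse_radon_measure) mean_of_approximation:
  assumes \<mu>: "\<mu> \<in> means m"
    and T: "continuous_on UNIV T" "inj T" "\<And>a. T a \<noteq> a"
    and F: "finite F" "F \<subseteq> linf m" and e: "0 < e"
  obtains S where "S \<in> compact_pos m" "S \<inter> T ` S = {}"
    "\<And>f. f \<in> F \<Longrightarrow> cmod (\<mu> f - mean_of m S f) < e"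
proof -
  \<comment> \<open>The level sets cost \<open>4 * d\<close> and the proportions \<open>d\<close>.\<close>
  define d where "d = e / 6"
  have d: "0 < d"
    using e by (simp add: d_def)
  obtain h :: "'a \<Rightarrow> ('a \<Rightarrow> complex) \<Rightarrow> int \<times> int" where
    h: "finite (range h)"
      "\<And>j K. compact K \<Longrightarrow> h -` {j} \<inter> K \<in> sets (completion m)"
      "\<And>f y z. f \<in> F \<Longrightarrow> h y = h z \<Longrightarrow> cmod (f y - f z) \<le> 2 * d"
    using finite_level_partition[OF F d] by metis
  have ind: "indicator (h -` {j}) \<in> linf m" for j
    using h(2) by (rule linf_indicator)
  define c where "c f j = f (SOME y. h y = j)" for f :: "'a \<Rightarrow> complex" and j
  have c: "cmod (f y - c f (h y)) \<le> 2 * d" if "f \<in> F" for f y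
    unfolding c_def using h(3)[OF that, of y "SOME z. h z = h y"] by (simp add: someI[of "\<lambda>z. h z = h y" y])
  have "bdd_above ((\<lambda>(f, j). cmod (c f j)) ` (F \<times> range h))"
    by (rule bdd_above_finite[OF finite_imageI[OF finite_cartesian_product[OF F(1) h(1)]]])
  then obtain M0 where M0: "\<And>f j. f \<in> F \<Longrightarrow> j \<in> range h \<Longrightarrow> cmod (c f j) \<le> M0"
    unfolding bdd_above_def by force
  define M where "M = max 1 M0"
  have M: "0 < M" "\<And>f j. f \<in> F \<Longrightarrow> j \<in> range h \<Longrightarrow> cmod (c f j) \<le> M"
    using M0 by (auto simp: M_def intro: max.coboundedI2)
  have card: "0 < card (range h)"
    using h(1) by (simp add: card_gt_0_iff)
  define \<eta> where "\<eta> = d / (M * card (range h))"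
  have \<eta>: "0 < \<eta>" "card (range h) * (M * \<eta>) = d"
    using d M(1) card by (auto simp: \<eta>_def)
  define p where "p j = Re (\<mu> (indicator (h -` {j})))" for j
  have "\<mu> (indicator (h -` {j})) \<in> \<real>\<^sub>\<ge>\<^sub>0" for j
  proof -
    have "{x. (indicator (h -` {j}) x :: complex) \<notin> \<real>\<^sub>\<ge>\<^sub>0} = {}"
      by (auto simp: indicator_def)
    then show ?thesis
      using mean_nonneg[OF \<mu> ind[of j]] locally_null_empty[of m] by simp
  qed
  then have p: "0 \<le> p j" "\<mu> (indicator (h -` {j})) = complex_of_real (p j)" for j
    by (auto simp: p_def complex_nonneg_Reals_iff complex_eq_iff)
  have "(\<lambda>x. \<Sum>j\<in>range h. indicator (h -` {j}) x) = (\<lambda>x. 1 :: complex)"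
  proof
    fix x show "(\<Sum>j\<in>range h. indicator (h -` {j}) x) = (1 :: complex)"
      using h(1) by (subst sum.remove[of _ "h x"]) (auto simp: indicator_def intro!: sum.neutral)
  qed
  then have "(\<Sum>j\<in>range h. \<mu> (indicator (h -` {j}))) = 1"
    using mean_sum[OF \<mu> linf_const h(1), of "\<lambda>j. indicator (h -` {j})"] ind mean_one[OF \<mu> linf_const] by simp
  then have p_sum: "(\<Sum>j\<in>range h. p j) = 1"
    by (simp add: p(2) flip: of_real_sum)
  have pos: "\<exists>C. compact C \<and> C \<subseteq> h -` {j} \<and> 0 < emeasure m C" if "0 < p j" for j
  proof -
    have "\<not> locally_null m (h -` {j})"
    proof
      assume "locally_null m (h -` {j})"
      then have "locally_null m {x. indicator (h -` {j}) x \<noteq> (0 :: complex)}"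
        by (rule locally_null_subset) (auto simp: indicator_def split: if_splits)
      then have "\<mu> (indicator (h -` {j})) = \<mu> (\<lambda>_. 0)"
        by (rule mean_cong[OF \<mu> ind linf_const])
      also have "\<dots> = 0"
        using mean_cmult[OF \<mu> linf_const, of 0 0] by simp
      finally show False
        using that p(2)[of j] by simp
    qed
    from compact_within_not_locally_null[OF h(2) this] show ?thesis
      by metis
  qed
  obtain S where S: "S \<in> compact_pos m" "S \<inter> T ` S = {}"
    "\<And>j. j \<in> range h \<Longrightarrow> S \<inter> h -` {j} \<in> sets m"
    "\<And>j. j \<in> range h \<Longrightarrow> \<bar>measure m (S \<inter> h -` {j}) / measure m S - p j\<bar> \<le> \<eta>"
  proof (rule compact_off_image_with_proportions[of "range h" "\<lambda>j. h -` {j}" p T \<eta>])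
    show "disjoint_family_on (\<lambda>j. h -` {j}) (range h)"
      by (auto simp: disjoint_family_on_def)
  qed (use h(1) p(1) p_sum pos T \<eta>(1) in \<open>blast+\<close>)
  let ?\<nu> = "mean_of m S"
  have \<nu>: "?\<nu> \<in> means m"
    by (rule mean_of_in_means[OF S(1)])
  have close: "cmod (\<mu> (indicator (h -` {j})) - ?\<nu> (indicator (h -` {j}))) \<le> \<eta>" if "j \<in> range h" for j
    using S(4)[OF that]
    by (simp add: p(2) mean_of_indicator[OF S(1) ind S(3)[OF that]] abs_minus_commute flip: of_real_diff of_real_divide)
  have "cmod (\<mu> f - ?\<nu> f) < e" if f: "f \<in> F" for f
  proof -
    have "f \<in> linf m"
      using f F(2) by blast
    have "cmod (\<mu> f - ?\<nu> f) \<le> 2 * (2 * d) +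
        (\<Sum>j\<in>range h. cmod (c f j) * cmod (\<mu> (indicator (h -` {j})) - ?\<nu> (indicator (h -` {j}))))"
      using d c[OF f] by (intro mean_diff_le[OF \<mu> \<nu> \<open>f \<in> linf m\<close> h(1) ind]) auto
    also have "(\<Sum>j\<in>range h. cmod (c f j) * cmod (\<mu> (indicator (h -` {j})) - ?\<nu> (indicator (h -` {j}))))
        \<le> (\<Sum>j\<in>range h. M * \<eta>)"
      using M f close by (intro sum_mono mult_mono) auto
    also have "\<dots> = d"
      using \<eta>(2) by simp
    finally show ?thesis
      using e by (simp add: d_def)
  qed
  with S(1,2) show thesis
    by (rule that)
qed

lemma means_topology_basic_neighbourhood:
  assumes W: "openin (means_topology m) W" "\<mu> \<in> W"
  obtains F e where "finite F" "F \<subseteq> linf m" "0 < e"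
    "\<And>\<nu>. \<nu> \<in> means m \<Longrightarrow> (\<And>f. f \<in> F \<Longrightarrow> cmod (\<mu> f - \<nu> f) < e) \<Longrightarrow> \<nu> \<in> W"
proof -
  obtain X where X: "openin (product_topology (\<lambda>_. euclidean) (linf m)) X" "W = X \<inter> means m"
    using W(1) unfolding means_topology_def openin_subtopology by blast
  have "\<mu> \<in> X"
    using W(2) X(2) by blast
  then obtain U where U: "finite {f \<in> linf m. U f \<noteq> UNIV}" "\<And>f. f \<in> linf m \<Longrightarrow> open (U f)"
    "\<mu> \<in> Pi\<^sub>E (linf m) U" "Pi\<^sub>E (linf m) U \<subseteq> X"
    using X(1) unfolding openin_product_topology_alt by auto
  define F where "F = {f \<in> linf m. U f \<noteq> UNIV}"
  have F: "finite F" "F \<subseteq> linf m"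
    using U(1) by (auto simp: F_def)
  have "\<exists>e>0. ball (\<mu> f) e \<subseteq> U f" if "f \<in> F" for f
  proof -
    have "f \<in> linf m"
      using that F(2) by blast
    then show ?thesis
      using U(2)[of f] U(3) open_contains_ball by blast
  qed
  then obtain r where r: "\<And>f. f \<in> F \<Longrightarrow> 0 < r f \<and> ball (\<mu> f) (r f) \<subseteq> U f"
    by metis
  define e where "e = Min (insert 1 (r ` F))"
  have e: "0 < e" "\<And>f. f \<in> F \<Longrightarrow> e \<le> r f"
    using F(1) r by (auto simp: e_def)
  show thesis
  proof (rule that[OF F e(1)])
    fix \<nu> assume \<nu>: "\<nu> \<in> means m" "\<And>f. f \<in> F \<Longrightarrow> cmod (\<mu> f - \<nu> f) < e"
    have "\<nu> f \<in> U f" if "f \<in> linf m" for f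
    proof (cases "f \<in> F")
      case True
      then have "\<nu> f \<in> ball (\<mu> f) (r f)"
        using \<nu>(2)[OF True] e(2)[OF True] by (simp add: dist_norm)
      then show ?thesis
        using r[OF True] by blast
    next
      case False
      then show ?thesis
        using that by (simp add: F_def)
    qed
    moreover have "\<nu> \<in> extensional (linf m)"
      using \<nu>(1) by (simp add: means_def linf_functional_def)
    ultimately have "\<nu> \<in> Pi\<^sub>E (linf m) U"
      by (simp add: PiE_iff)
    then show "\<nu> \<in> W"
      using U(4) X(2) \<nu>(1) by blast
  qed
qed

lemma topspace_means_topology: "topspace (means_topology m) = means m"
  by (auto simp: means_topology_def means_def linf_functional_def PiE_def)

lemma net_of_neighbourhoods:
  assumes x: "x \<in> topspace X" and S: "\<And>W. openin X W \<Longrightarrow> x \<in> W \<Longrightarrow> f (S W) \<in> W"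
  shows "directed_set {W. openin X W \<and> x \<in> W} (\<lambda>A B. B \<subseteq> A)"
    and "limitin X (\<lambda>W. f (S W)) x (tails {W. openin X W \<and> x \<in> W} (\<lambda>A B. B \<subseteq> A))"
proof -
  show dir: "directed_set {W. openin X W \<and> x \<in> W} (\<lambda>A B. B \<subseteq> A)"
    unfolding directed_set_def
  proof (intro conjI ballI impI)
    show "{W. openin X W \<and> x \<in> W} \<noteq> {}"
      using x openin_topspace by blast
    fix A B assume "A \<in> {W. openin X W \<and> x \<in> W}" "B \<in> {W. openin X W \<and> x \<in> W}"
    then show "\<exists>C\<in>{W. openin X W \<and> x \<in> W}. C \<subseteq> A \<and> C \<subseteq> B"
      by (intro bexI[of _ "A \<inter> B"]) auto
  qed auto
  show "limitin X (\<lambda>W. f (S W)) x (tails {W. openin X W \<and> x \<in> W} (\<lambda>A B. B \<subseteq> A))"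
    unfolding limitin_def eventually_tails[OF dir]
  proof (intro conjI allI impI x)
    fix U assume U: "openin X U \<and> x \<in> U"
    then show "\<exists>A\<in>{W. openin X W \<and> x \<in> W}. \<forall>B\<in>{W. openin X W \<and> x \<in> W}. B \<subseteq> A \<longrightarrow> f (S B) \<in> U"
      using S by (intro bexI[of _ U]) blast+
  qed
qed

section \<open>Haar measure of a nondiscrete group\<close>

lemma left_haar_radon:
  assumes "left_haar_measure m"
  shows "radon_measure m"
proof
qed (use assms in \<open>auto simp: left_haar_measure_def\<close>)

lemma left_haar_singletons_equal:
  assumes m: "left_haar_measure m"
  shows "emeasure m {b} = emeasure m {a}"
proof -
  have "emeasure m ((+) (b - a) ` {a}) = emeasure m {a}"
    using m by (simp only: left_haar_measure_def) (meson borel_closed closed_singleton)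
  then show ?thesis
    by simp
qed

text \<open>
  By translation invariance all points have the same measure. If it were positive, a compact
  neighbourhood of \<open>0\<close>, having finite measure, would be finite; in a Hausdorff group this makes
  \<open>0\<close>, and by translation every point, isolated.
\<close>

lemma left_haar_singleton_null:
  fixes m :: "'a::{topological_group_add, t2_space} measure"
  assumes lc: "locally_compact_space (euclidean :: 'a topology)"
    and nd: "(euclidean :: 'a topology) \<noteq> discrete_topology UNIV"
    and m: "left_haar_measure m"
  shows "emeasure m {a} = 0"
proof (rule ccontr)
  assume nz: "emeasure m {a} \<noteq> 0"
  interpret radon_measure m
    by (rule left_haar_radon[OF m])
  define c where "c = measure m {a}"
  have c: "measure m {b} = c" for b
    unfolding c_def measure_def using left_haar_singletons_equal[OF m, of b a] by simp
  have "0 < c"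
    using nz compact_finite[of "{a}"] by (simp add: c_def measure_def enn2real_positive_iff less_top zero_less_iff_neq_zero)
  obtain U K where U: "open U" "compact K" "0 \<in> U" "U \<subseteq> (K :: 'a set)"
    using lc[unfolded locally_compact_space_def, rule_format, of 0] by auto
  have "finite K"
  proof (rule ccontr)
    assume inf: "infinite K"
    obtain n where n: "measure m K < of_nat n * c"
      using reals_Archimedean3[OF \<open>0 < c\<close>] by blast
    obtain B where B: "finite B" "card B = n" "B \<subseteq> K"
      using infinite_arbitrarily_large[OF inf] by blast
    have "of_nat n * c = (\<Sum>b\<in>B. measure m {b})"
      using B(2) c by simp
    also have "\<dots> = measure m B"
      using compact_finite[of "{b}" for b] B(1)
      by (intro measure_eq_sum_singleton[symmetric]) (auto simp: less_top[symmetric])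
    also have "\<dots> \<le> measure m K"
      using B U(2) by (intro measure_mono_fmeasurable compact_fmeasurable) (auto intro: finite_imp_compact borel_compact)
    finally show False
      using n by simp
  qed
  then have "finite (U - {0})"
    using U(4) by (auto intro: finite_subset)
  then have "open (U - (U - {0}))"
    using U(1) by (intro open_Diff finite_imp_closed)
  moreover have "U - (U - {0}) = {0}"
    using U(3) by blast
  ultimately have "open {0 :: 'a}"
    by simp
  have "open {b}" for b :: 'a
  proof -
    have "open ((\<lambda>y. - b + y) -` {0})"
      by (intro open_vimage \<open>open {0}\<close> continuous_intros)
    moreover have "(\<lambda>y. - b + y) -` {0} = {b}"
      by (auto simp: neg_eq_iff_add_eq_0 [symmetric])
    ultimately show ?thesis
      by simp
  qed
  then have "discrete_topology UNIV = (euclidean :: 'a topology)"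
    by (simp add: discrete_topology_unique)
  with nd show False
    by simp
qed

theorem mainTheorem9:
  fixes m :: "'a::{topological_group_add, t2_space} measure"
    and \<mu> :: "('a \<Rightarrow> complex) \<Rightarrow> complex"
    and x :: 'a
  assumes "locally_compact_space (euclidean :: 'a topology)"
    and "(euclidean :: 'a topology) \<noteq> discrete_topology UNIV"
    and "left_haar_measure m"
    and "\<mu> \<in> means m"
    and "x \<noteq> 0"
  shows "\<exists>(D :: (('a \<Rightarrow> complex) \<Rightarrow> complex) set set) le (S :: _ \<Rightarrow> 'a set).
           directed_set D le \<and>
           (\<forall>\<alpha>\<in>D. S \<alpha> \<in> compact_pos m) \<and>
           limitin (means_topology m) (\<lambda>\<alpha>. mean_of m (S \<alpha>)) \<mu> (tails D le) \<and>
           (\<forall>\<alpha>\<in>D. S \<alpha> \<inter> (+) x ` S \<alpha> = {})"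
proof -
  interpret diffuse_radon_measure m
    using left_haar_radon[OF assms(3)] left_haar_singleton_null[OF assms(1-3)]
    by (simp add: diffuse_radon_measure_def diffuse_radon_measure_axioms_def)
  let ?X = "means_topology m"
  let ?D = "{W. openin ?X W \<and> \<mu> \<in> W}"
  have "\<exists>S. S \<in> compact_pos m \<and> S \<inter> (+) x ` S = {} \<and> mean_of m S \<in> W"
    if W: "openin ?X W" "\<mu> \<in> W" for W
  proof -
    obtain F e where F: "finite F" "F \<subseteq> linf m" "0 < e"
      and FW: "\<And>\<nu>. \<nu> \<in> means m \<Longrightarrow> (\<And>f. f \<in> F \<Longrightarrow> cmod (\<mu> f - \<nu> f) < e) \<Longrightarrow> \<nu> \<in> W"
      using means_topology_basic_neighbourhood[OF W] by metis
    have "continuous_on UNIV ((+) x)" "inj ((+) x)" "\<And>a. x + a \<noteq> a"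
      using assms(5) add_right_cancel[of x _ 0] by (auto intro!: continuous_on_add continuous_on_const continuous_on_id)
    from mean_of_approximation[OF assms(4) this F]
    obtain S where "S \<in> compact_pos m" "S \<inter> (+) x ` S = {}"
      "\<And>f. f \<in> F \<Longrightarrow> cmod (\<mu> f - mean_of m S f) < e"
      by metis
    then show ?thesis
      using FW mean_of_in_means by blast
  qed
  then obtain S where S: "\<And>W. openin ?X W \<Longrightarrow> \<mu> \<in> W \<Longrightarrow>
      S W \<in> compact_pos m \<and> S W \<inter> (+) x ` S W = {} \<and> mean_of m (S W) \<in> W"
    by metis
  have "\<mu> \<in> topspace ?X"
    using assms(4) by (simp add: topspace_means_topology)
  note net = net_of_neighbourhoods[of \<mu> ?X "mean_of m" S, OF this]
  show ?thesis
    using net S by (intro exI[of _ ?D] exI[of _ "\<lambda>A B. B \<subseteq> A"] exI[of _ S]) blast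
qed

end
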